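(* Let $(\Gamma,v_0)$ be a pointed graph satisfying the following two conditions: (S1) for each $i\in I(\Gamma)$, the function $v\mapsto |S_i(v)|$ is constant on the vertex set $V$; (S2) for all $i,j,k\in I(\Gamma)$, the function $v\mapsto |S_i(v)\cap S_j(v_0)|$ is constant on $S_k(v_0)$. Then for all $m\in\mathbb{N}$ and all $i_1,i_2,\ldots,i_m\in I(\Gamma)$, $$PL(i_1,i_2,\ldots,i_m)=J(i_1,i_2,\ldots,i_m).$$
   Context: Graphs: $\Gamma$ is a graph with vertex set $V$, $d$ is the shortest-path distance, $v_0\in V$ is a fixed base point, and $(\Gamma,v_0)$ is called a pointed graph. For $v\in V$ put $|v|=d(v_0,v)$. For $w\in V$ and $n\in\mathbb{N}_0=\{0,1,2,\dots\}$ put $S_n(w)=\{w'\in V: d(w,w')=n\}$. Put $I(\Gamma)=I(\Gamma,v_0)=\{n\in\mathbb{N}_0: |v|=n \text{ for some } v\in V\}$ and $M(\Gamma)=\sup I(\Gamma)$. $|A|$ denotes the cardinality of a set $A$. Standing assumptions on every graph: (i) simple, connected and locally finite; (ii) at most countably many vertices; (iii) if $\Gamma$ is finite, $S_{M(\Gamma)}(v)\neq\varnothing$ for every vertex $v$. (Consequently $S_j(v)\ne\varnothing$ for all $v\in V$, $j\in I(\Gamma)$.) Product: $H(\Gamma)=\{x_i\}_{i\in I(\Gamma)}$ is a set of formal symbols and $\mathbb{C}H(\Gamma)$ the free complex vector space on it. For $i,j,k\in I(\Gamma)$, $$p_{i,j}^k=\frac{1}{|S_i(v_0)|}\sum_{v\in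 S_i(v_0)}\frac{|S_j(v)\cap S_k(v_0)|}{|S_j(v)|},$$ and $\circ$ is the bilinear (possibly non-associative, non-commutative) product on $\mathbb{C}H(\Gamma)$ with $x_i\circ x_j=\sum_{k\in I(\Gamma)}p_{i,j}^kx_k$ (a finite sum). For $i_1,\ldots,i_m\in I(\Gamma)$ define $$PL(i_1,\ldots,i_m)=((\cdots((x_{i_1}\circ x_{i_2})\circ x_{i_3})\circ\cdots)\circ x_{i_{m-1}})\circ x_{i_m}$$ (the left-bracketed product; $PL(i_1)=x_{i_1}$), and $$J(i_1,\ldots,i_m)=\sum_{v_1\in S_{i_1}(v_0)}\sum_{v_2\in S_{i_2}(v_1)}\cdots\sum_{v_m\in S_{i_m}(v_{m-1})}\frac{1}{\prod_{j=1}^m|S_{i_j}(v_{j-1})|}\,x_{|v_m|}.$$ *)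

theory Defs
  imports
    "Graph_Theory.Graph_Theory"
    "HOL-Library.Countable_Set"
    "HOL-Library.Poly_Mapping"
begin

section \<open>Distance and spheres\<close>

text \<open>
  An undirected simple graph is a loop-free symmetric \<open>pair_pre_digraph\<close>; every edge is
  represented by its two arcs. The value of the distance is only meaningful when \<open>v\<close> is
  reachable from \<open>u\<close>.
\<close>

definition gdist :: "'a pair_pre_digraph \<Rightarrow> 'a \<Rightarrow> 'a \<Rightarrow> nat" where
  "gdist G u v = (LEAST n. \<exists>p. pre_digraph.awalk (with_proj G) u p v \<and> length p = n)"

definition sphere :: "'a pair_pre_digraph \<Rightarrow> nat \<Rightarrow> 'a \<Rightarrow> 'a set" where
  "sphere G n w = {w' \<in> pverts G. gdist G w w' = n}"

definition levels :: "'a pair_pre_digraph \<Rightarrow> 'a \<Rightarrow> nat set" where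
  "levels G v0 = {n. \<exists>v \<in> pverts G. gdist G v0 v = n}"

text \<open>
  The supremum is taken in \<open>nat\<close>, so this is the intended value only if \<open>levels G v0\<close> is finite.
  It is used for finite graphs only.
\<close>

definition max_level :: "'a pair_pre_digraph \<Rightarrow> 'a \<Rightarrow> nat" where
  "max_level G v0 = Sup (levels G v0)"

locale pointed_graph = pair_bidirected_digraph G
  for G :: "'a pair_pre_digraph" +
  fixes v0 :: 'a
  assumes base_in_verts: "v0 \<in> pverts G"
    and connected_graph: "connected (with_proj G)"
    and locally_finite: "\<And>v. v \<in> pverts G \<Longrightarrow> finite (out_arcs (with_proj G) v)"
    and countable_verts: "countable (pverts G)"
    and finite_sphere_nonempty:
      "finite (pverts G) \<Longrightarrow> v \<in> pverts G \<Longrightarrow> sphere G (max_level G v0) v \<noteq> {}"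

text \<open>The distance agrees with the shortest-path cost for unit weights.\<close>

lemma (in pointed_graph) gdist_eq_shortest_path:
  assumes "u \<in> pverts G" "v \<in> pverts G"
  shows "ereal (real (gdist G u v)) = wf_digraph.\<mu> (with_proj G) (\<lambda>_. 1) u v"
proof -
  have "strongly_connected (with_proj G)"
    using pair_sym_arcs connected_graph by (rule symmetric_connected_imp_strongly_connected)
  then have "u \<rightarrow>\<^sup>*\<^bsub>with_proj G\<^esub> v"
    using assms by (auto simp: strongly_connected_def)
  then obtain p0 where p0: "awalk u p0 v"
    by (auto simp: reachable_awalk)
  have cost: "awalk_cost (\<lambda>_. 1) p = real (length p)" for p :: "('a \<times> 'a) list"
    by (induction p) auto
  have ex: "\<exists>p. awalk u p v \<and> length p = gdist G u v"
    unfolding gdist_def by (rule LeastI[where k = "length p0"]) (use p0 in auto)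
  have le: "gdist G u v \<le> length p" if "awalk u p v" for p
    unfolding gdist_def by (rule Least_le) (use that in auto)
  show ?thesis
    unfolding \<mu>_def
  proof (rule antisym)
    show "ereal (real (gdist G u v)) \<le> (INF p\<in>{p. awalk u p v}. ereal (awalk_cost (\<lambda>_. 1) p))"
      by (rule INF_greatest) (use le cost in auto)
    obtain p where p: "awalk u p v" "length p = gdist G u v"
      using ex by blast
    show "(INF p\<in>{p. awalk u p v}. ereal (awalk_cost (\<lambda>_. 1) p)) \<le> ereal (real (gdist G u v))"
      by (rule INF_lower2[where i = p]) (use p cost in auto)
  qed
qed


section \<open>The product\<close>

text \<open>
  The free complex vector space on the symbols \<open>x\<^sub>i\<close>, \<open>i \<in> levels G v0\<close>, is the set of those
  elements of \<open>nat \<Rightarrow>\<^sub>0 complex\<close> whose keys lie in \<open>levels G v0\<close>. The ring multiplication that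
  \<open>Poly_Mapping\<close> provides on this type is not used.
\<close>

abbreviation free_space :: "'a pair_pre_digraph \<Rightarrow> 'a \<Rightarrow> (nat \<Rightarrow>\<^sub>0 complex) set" where
  "free_space G v0 \<equiv> {f. Poly_Mapping.keys f \<subseteq> levels G v0}"

definition xb :: "nat \<Rightarrow> (nat \<Rightarrow>\<^sub>0 complex)" where
  "xb i = Poly_Mapping.single i 1"

definition scale :: "complex \<Rightarrow> (nat \<Rightarrow>\<^sub>0 complex) \<Rightarrow> (nat \<Rightarrow>\<^sub>0 complex)" where
  "scale c f = Poly_Mapping.map ((*) c) f"

definition pcoeff :: "'a pair_pre_digraph \<Rightarrow> 'a \<Rightarrow> nat \<Rightarrow> nat \<Rightarrow> nat \<Rightarrow> complex" where
  "pcoeff G v0 i j k =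
     1 / of_nat (card (sphere G i v0)) *
     (\<Sum>v \<in> sphere G i v0.
        of_nat (card (sphere G j v \<inter> sphere G k v0)) / of_nat (card (sphere G j v)))"

text \<open>
  The index set \<open>levels G v0\<close> may be infinite, so the sum over \<open>k\<close> is restricted to the nonzero
  coefficients, of which there are finitely many.
\<close>

definition basis_prod :: "'a pair_pre_digraph \<Rightarrow> 'a \<Rightarrow> nat \<Rightarrow> nat \<Rightarrow> (nat \<Rightarrow>\<^sub>0 complex)" where
  "basis_prod G v0 i j =
     (\<Sum>k \<in> {k \<in> levels G v0. pcoeff G v0 i j k \<noteq> 0}. scale (pcoeff G v0 i j k) (xb k))"

lemma finite_pcoeff_support: "finite {k. pcoeff G v0 i j k \<noteq> 0}"
proof (cases "finite (sphere G i v0)")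
  case True
  let ?A = "{v \<in> sphere G i v0. finite (sphere G j v)}"
  have "{k. pcoeff G v0 i j k \<noteq> 0} \<subseteq> (\<Union>v \<in> ?A. gdist G v0 ` sphere G j v)"
  proof
    fix k
    assume "k \<in> {k. pcoeff G v0 i j k \<noteq> 0}"
    then have "(\<Sum>v \<in> sphere G i v0. of_nat (card (sphere G j v \<inter> sphere G k v0)) /
        of_nat (card (sphere G j v)) :: complex) \<noteq> 0"
      by (simp add: pcoeff_def)
    then obtain v where v: "v \<in> sphere G i v0"
      "(of_nat (card (sphere G j v \<inter> sphere G k v0)) / of_nat (card (sphere G j v)) :: complex) \<noteq> 0"
      by (rule sum.not_neutral_contains_not_neutral)
    then have "finite (sphere G j v)" "sphere G j v \<inter> sphere G k v0 \<noteq> {}"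
      by (auto intro: card_ge_0_finite)
    then show "k \<in> (\<Union>v \<in> ?A. gdist G v0 ` sphere G j v)"
      using v(1) by (auto simp: sphere_def)
  qed
  then show ?thesis
    by (rule finite_subset) (use True in auto)
qed (simp add: pcoeff_def)

text \<open>The bilinear extension.\<close>

definition gprod ::
    "'a pair_pre_digraph \<Rightarrow> 'a \<Rightarrow> (nat \<Rightarrow>\<^sub>0 complex) \<Rightarrow> (nat \<Rightarrow>\<^sub>0 complex) \<Rightarrow> (nat \<Rightarrow>\<^sub>0 complex)" where
  "gprod G v0 f g =
     (\<Sum>i \<in> Poly_Mapping.keys f. \<Sum>j \<in> Poly_Mapping.keys g.
        scale (Poly_Mapping.lookup f i * Poly_Mapping.lookup g j) (basis_prod G v0 i j))"

lemma lookup_scale [simp]: "Poly_Mapping.lookup (scale c f) k = c * Poly_Mapping.lookup f k"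
  by (simp add: scale_def Poly_Mapping.map.rep_eq when_def)

lemma scale_zero_left [simp]: "scale 0 f = 0"
  and scale_one [simp]: "scale 1 f = f"
  and scale_add_left: "scale (a + b) f = scale a f + scale b f"
  and scale_add_right: "scale a (f + g) = scale a f + scale a g"
  and scale_scale: "scale a (scale b f) = scale (a * b) f"
  by (auto intro!: poly_mapping_eqI simp: lookup_add algebra_simps)

lemma scale_sum: "scale a (\<Sum>i\<in>A. f i) = (\<Sum>i\<in>A. scale a (f i))"
proof (induction A rule: infinite_finite_induct)
  case (insert i A)
  then show ?case by (simp add: scale_add_right)
qed (auto intro!: poly_mapping_eqI)

lemma gprod_superset:
  assumes "finite A" "Poly_Mapping.keys f \<subseteq> A" "finite B" "Poly_Mapping.keys g \<subseteq> B"
  shows "gprod G v0 f g =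
    (\<Sum>i\<in>A. \<Sum>j\<in>B. scale (Poly_Mapping.lookup f i * Poly_Mapping.lookup g j) (basis_prod G v0 i j))"
proof -
  have "gprod G v0 f g = (\<Sum>i\<in>Poly_Mapping.keys f. \<Sum>j\<in>B.
      scale (Poly_Mapping.lookup f i * Poly_Mapping.lookup g j) (basis_prod G v0 i j))"
    unfolding gprod_def
    by (intro sum.cong refl sum.mono_neutral_left) (use assms in \<open>auto simp: in_keys_iff\<close>)
  also have "\<dots> = (\<Sum>i\<in>A. \<Sum>j\<in>B.
      scale (Poly_Mapping.lookup f i * Poly_Mapping.lookup g j) (basis_prod G v0 i j))"
    by (intro sum.mono_neutral_left) (use assms in \<open>auto simp: in_keys_iff\<close>)
  finally show ?thesis .
qed

lemma gprod_basis: "gprod G v0 (xb i) (xb j) = basis_prod G v0 i j"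
  by (simp add: gprod_def xb_def)

lemma gprod_add_left: "gprod G v0 (f + f') g = gprod G v0 f g + gprod G v0 f' g"
proof -
  let ?A = "Poly_Mapping.keys f \<union> Poly_Mapping.keys f'"
  have "Poly_Mapping.keys (f + f') \<subseteq> ?A" by (rule Poly_Mapping.keys_add)
  then show ?thesis
    by (simp add: gprod_superset[of ?A _ "Poly_Mapping.keys g"] lookup_add distrib_right
        scale_add_left sum.distrib)
qed

lemma gprod_add_right: "gprod G v0 f (g + g') = gprod G v0 f g + gprod G v0 f g'"
proof -
  let ?B = "Poly_Mapping.keys g \<union> Poly_Mapping.keys g'"
  have "Poly_Mapping.keys (g + g') \<subseteq> ?B" by (rule Poly_Mapping.keys_add)
  then show ?thesis
    by (simp add: gprod_superset[of "Poly_Mapping.keys f" _ ?B] lookup_add distrib_left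
        scale_add_left sum.distrib)
qed

lemma keys_scale: "Poly_Mapping.keys (scale c f) \<subseteq> Poly_Mapping.keys f"
  by (auto simp: in_keys_iff)

lemma gprod_scale_left: "gprod G v0 (scale c f) g = scale c (gprod G v0 f g)"
  using keys_scale[of c f]
  by (simp add: gprod_superset[of "Poly_Mapping.keys f" _ "Poly_Mapping.keys g"] scale_sum
      scale_scale mult.assoc)

lemma gprod_scale_right: "gprod G v0 f (scale c g) = scale c (gprod G v0 f g)"
  using keys_scale[of c g]
  by (simp add: gprod_superset[of "Poly_Mapping.keys f" _ "Poly_Mapping.keys g"] scale_sum
      scale_scale mult.left_commute)

lemma gprod_in_free_space: "gprod G v0 f g \<in> free_space G v0"
proof -
  have *: "Poly_Mapping.lookup (\<Sum>i\<in>A. F i) k = (\<Sum>i\<in>A. Poly_Mapping.lookup (F i) k)"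
    for A :: "nat set" and F :: "nat \<Rightarrow> nat \<Rightarrow>\<^sub>0 complex" and k
    by (rule lookup_sum)
  have "Poly_Mapping.lookup (basis_prod G v0 i j) k = 0" if "k \<notin> levels G v0" for i j k
    unfolding basis_prod_def * using that
    by (intro sum.neutral) (auto simp: xb_def lookup_single when_def)
  then have "Poly_Mapping.lookup (gprod G v0 f g) k = 0" if "k \<notin> levels G v0" for k
    using that by (simp add: gprod_def *)
  then show ?thesis by (auto simp: in_keys_iff)
qed


section \<open>Left-bracketed products and iterated jumps\<close>

text \<open>
  The index tuple is the list \<open>ns\<close>; both notions are only meant for nonempty lists.
\<close>

definition PL :: "'a pair_pre_digraph \<Rightarrow> 'a \<Rightarrow> nat list \<Rightarrow> (nat \<Rightarrow>\<^sub>0 complex)" where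
  "PL G v0 ns = foldl (\<lambda>f i. gprod G v0 f (xb i)) (xb (hd ns)) (tl ns)"

text \<open>
  The nested sums: \<open>v\<close> is the vertex \<open>v\<^sub>j\<close> reached so far and \<open>D\<close> the product of the
  sphere sizes collected so far.
\<close>

primrec J_from :: "'a pair_pre_digraph \<Rightarrow> 'a \<Rightarrow> nat \<Rightarrow> 'a \<Rightarrow> nat list \<Rightarrow> (nat \<Rightarrow>\<^sub>0 complex)" where
  "J_from G v0 D v [] = scale (1 / of_nat D) (xb (gdist G v0 v))"
| "J_from G v0 D v (i # ns) =
     (\<Sum>v' \<in> sphere G i v. J_from G v0 (D * card (sphere G i v)) v' ns)"

definition J :: "'a pair_pre_digraph \<Rightarrow> 'a \<Rightarrow> nat list \<Rightarrow> (nat \<Rightarrow>\<^sub>0 complex)" where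
  "J G v0 ns = J_from G v0 1 v0 ns"

end

theory Submission
  imports Defs
begin

text \<open>
  Under (S1) and (S2), \<open>x\<^bsub>|v|\<^esub> \<circ> x\<^sub>i\<close> is the average of \<open>x\<^bsub>|w|\<^esub>\<close> over \<open>w \<in> S\<^sub>i(v)\<close>, for every single
  vertex \<open>v\<close>: the terms of the sum defining \<open>p\<^sub>i\<^sub>j\<^sup>k\<close> are all equal. By linearity of right
  multiplication, the random walk started at \<open>v\<close> with jumps \<open>i, \<dots>, k\<close> therefore has expectation
  \<open>((x\<^bsub>|v|\<^esub> \<circ> x\<^sub>i) \<circ> \<dots>) \<circ> x\<^sub>k\<close>. All vertices reached by the first jump from \<open>v0\<close> have the same level,
  so the remaining jumps produce the left-bracketed product.
\<close>

lemma xb_lookup: "Poly_Mapping.lookup (xb i) k = (if i = k then 1 else 0)"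
  by (simp add: xb_def lookup_single when_def)

lemma gdist_in_levels: "v \<in> pverts G \<Longrightarrow> gdist G v0 v \<in> levels G v0"
  by (auto simp: levels_def)

context pointed_graph
begin

lemma awalk_of_length_gdist:
  assumes "u \<in> pverts G" "v \<in> pverts G"
  shows "\<exists>p. awalk u p v \<and> length p = gdist G u v"
proof -
  have "strongly_connected (with_proj G)"
    using pair_sym_arcs connected_graph by (rule symmetric_connected_imp_strongly_connected)
  then have "u \<rightarrow>\<^sup>*\<^bsub>with_proj G\<^esub> v"
    using assms by (auto simp: strongly_connected_def)
  then obtain p where "awalk u p v"
    by (auto simp: reachable_awalk)
  then show ?thesis
    unfolding gdist_def by - (rule LeastI[where k = "length p"], auto)
qed

text \<open>Local finiteness enters here: a walk of length \<open>Suc n\<close> starts with one of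
  finitely many arcs out of \<open>u\<close> and continues with a walk of length \<open>n\<close>
  from the head of that arc.\<close>

lemma finite_awalk_ends: "finite {w. \<exists>p. awalk u p w \<and> length p = n}"
proof (induction n arbitrary: u)
  case 0
  have "{w. \<exists>p. awalk u p w \<and> length p = 0} \<subseteq> {u}"
    by (auto simp: awalk_def)
  then show ?case by (rule finite_subset) simp
next
  case (Suc n)
  show ?case
  proof (cases "u \<in> pverts G")
    case True
    have "{w. \<exists>p. awalk u p w \<and> length p = Suc n} \<subseteq>
        (\<Union>e \<in> out_arcs (with_proj G) u. {w. \<exists>p. awalk (snd e) p w \<and> length p = n})"
      by (force simp: length_Suc_conv awalk_Cons_iff out_arcs_def)
    then show ?thesis
      by (rule finite_subset) (intro finite_UN_I locally_finite[OF True] Suc.IH)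
  next
    case False
    then have "{w. \<exists>p. awalk u p w \<and> length p = Suc n} = {}"
      by (auto simp: awalk_def)
    then show ?thesis by (simp only: finite.emptyI)
  qed
qed

lemma finite_sphere:
  assumes "u \<in> pverts G"
  shows "finite (sphere G n u)"
proof (rule finite_subset[OF _ finite_awalk_ends])
  show "sphere G n u \<subseteq> {w. \<exists>p. awalk u p w \<and> length p = n}"
    using awalk_of_length_gdist[OF assms] by (auto simp: sphere_def)
qed

text \<open>Averages over the base sphere divide by this cardinality. As division by zero gives 0,
  the average of a constant is that constant only if the sphere is finite and nonempty.\<close>

lemma card_base_sphere_pos:
  assumes "i \<in> levels G v0"
  shows "0 < card (sphere G i v0)"
  using assms finite_sphere[OF base_in_verts] by (auto simp: card_gt_0_iff levels_def sphere_def)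

lemma basis_prod_lookup: "Poly_Mapping.lookup (basis_prod G v0 i j) k = pcoeff G v0 i j k"
proof -
  have fin: "finite {k \<in> levels G v0. pcoeff G v0 i j k \<noteq> 0}"
    using finite_pcoeff_support[of G v0 i j] by simp
  \<comment> \<open>This makes the formula valid for every \<open>k\<close>, although
    \<open>basis_prod\<close> sums over levels only.\<close>
  have "pcoeff G v0 i j k = 0" if "k \<notin> levels G v0"
  proof -
    have "sphere G k v0 = {}"
      using that by (auto simp: sphere_def levels_def)
    then show ?thesis by (simp add: pcoeff_def)
  qed
  then show ?thesis
    using fin by (auto simp: basis_prod_def lookup_sum xb_lookup if_distrib[where f = "(*) _"]
        cong: if_cong)
qed

end

lemma gprod_zero_left: "gprod G v0 0 g = 0"
  by (simp add: gprod_def)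

text \<open>Covers empty and infinite index sets in \<open>foldl_gprod_sum\<close>.\<close>

lemma foldl_gprod_zero: "foldl (\<lambda>f i. gprod G v0 f (xb i)) 0 ns = 0"
  by (induction ns) (simp_all add: gprod_zero_left)

lemma foldl_gprod_add:
  "foldl (\<lambda>f i. gprod G v0 f (xb i)) (f + f') ns =
    foldl (\<lambda>f i. gprod G v0 f (xb i)) f ns + foldl (\<lambda>f i. gprod G v0 f (xb i)) f' ns"
  by (induction ns arbitrary: f f') (simp_all add: gprod_add_left)

lemma foldl_gprod_scale:
  "foldl (\<lambda>f i. gprod G v0 f (xb i)) (scale c f) ns =
    scale c (foldl (\<lambda>f i. gprod G v0 f (xb i)) f ns)"
  by (induction ns arbitrary: f) (simp_all add: gprod_scale_left)

lemma foldl_gprod_sum: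
  "foldl (\<lambda>f i. gprod G v0 f (xb i)) (\<Sum>a\<in>A. F a) ns =
    (\<Sum>a\<in>A. foldl (\<lambda>f i. gprod G v0 f (xb i)) (F a) ns)"
  by (induction A rule: infinite_finite_induct)
    (simp_all add: foldl_gprod_zero foldl_gprod_add)

text \<open>The accumulated denominator only multiplies the final weights, so it factors out. An
  induction on the jumps can then restart at every vertex with \<open>D = 1\<close>.\<close>

lemma J_from_eq_scale: "J_from G v0 D v ns = scale (1 / of_nat D) (J_from G v0 1 v ns)"
proof (induction ns arbitrary: D v)
  case (Cons i ns)
  show ?case
    by (simp add: Cons.IH[of "D * card (sphere G i v)"] Cons.IH[of "card (sphere G i v)"]
        scale_sum scale_scale)
qed simp

locale distance_homogeneous_graph = pointed_graph +
  assumes S1: "\<lbrakk>i \<in> levels G v0; u \<in> pverts G; v \<in> pverts G\<rbrakk> \<Longrightarrow>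
      card (sphere G i u) = card (sphere G i v)"
    and S2: "\<lbrakk>i \<in> levels G v0; j \<in> levels G v0; k \<in> levels G v0;
        u \<in> sphere G k v0; v \<in> sphere G k v0\<rbrakk> \<Longrightarrow>
      card (sphere G i u \<inter> sphere G j v0) = card (sphere G i v \<inter> sphere G j v0)"
begin

lemma pcoeff_eq:
  assumes i: "i \<in> levels G v0" and v: "v \<in> pverts G"
  shows "pcoeff G v0 (gdist G v0 v) i k =
    of_nat (card (sphere G i v \<inter> sphere G k v0)) / of_nat (card (sphere G i v))"
\<comment> \<open>(S2) speaks of levels only; for any other \<open>k\<close> the sphere around
  \<open>v0\<close> is empty and both sides vanish.\<close>
proof (cases "k \<in> levels G v0")
  case True
  let ?S = "sphere G (gdist G v0 v) v0"
  have "of_nat (card (sphere G i u \<inter> sphere G k v0)) / of_nat (card (sphere G i u)) =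
      (of_nat (card (sphere G i v \<inter> sphere G k v0)) / of_nat (card (sphere G i v)) :: complex)"
    if u: "u \<in> ?S" for u
  proof -
    \<comment> \<open>(S1) equates the denominators and (S2) the numerators.\<close>
    have "card (sphere G i u) = card (sphere G i v)"
      using u v by (intro S1[OF i]) (auto simp: sphere_def)
    moreover have "card (sphere G i u \<inter> sphere G k v0) = card (sphere G i v \<inter> sphere G k v0)"
      using u v by (intro S2[OF i True gdist_in_levels[OF v]]) (auto simp: sphere_def)
    ultimately show ?thesis by simp
  qed
  then show ?thesis
    using card_base_sphere_pos[OF gdist_in_levels[OF v]] by (simp add: pcoeff_def)
next
  case False
  then have "sphere G k v0 = {}"
    by (auto simp: sphere_def levels_def)
  then show ?thesis by (simp add: pcoeff_def)
qed

lemma basis_prod_eq_average: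
  assumes i: "i \<in> levels G v0" and v: "v \<in> pverts G"
  shows "basis_prod G v0 (gdist G v0 v) i =
    (\<Sum>w \<in> sphere G i v. scale (1 / of_nat (card (sphere G i v))) (xb (gdist G v0 w)))"
proof (rule poly_mapping_eqI)
  fix k
  \<comment> \<open>The coefficient of \<open>xb k\<close> in the average counts the endpoints
    \<open>w\<close> of level \<open>k\<close>.\<close>
  have "sphere G i v \<inter> {w. gdist G v0 w = k} = sphere G i v \<inter> sphere G k v0"
    by (auto simp: sphere_def)
  then have "(\<Sum>w \<in> sphere G i v. if gdist G v0 w = k then 1 else 0 :: complex) =
      of_nat (card (sphere G i v \<inter> sphere G k v0))"
    using finite_sphere[OF v, of i] by (simp add: sum.If_cases)
  then show "Poly_Mapping.lookup (basis_prod G v0 (gdist G v0 v) i) k = Poly_Mapping.lookup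
      (\<Sum>w \<in> sphere G i v. scale (1 / of_nat (card (sphere G i v))) (xb (gdist G v0 w))) k"
    by (simp add: basis_prod_lookup pcoeff_eq[OF i v] lookup_sum xb_lookup
        flip: sum_divide_distrib)
qed

lemma J_from_eq_foldl_gprod:
  assumes "set ns \<subseteq> levels G v0" "v \<in> pverts G"
  shows "J_from G v0 1 v ns = foldl (\<lambda>f i. gprod G v0 f (xb i)) (xb (gdist G v0 v)) ns"
  using assms
proof (induction ns arbitrary: v)
  case (Cons i ns)
  let ?c = "1 / of_nat (card (sphere G i v)) :: complex"
  have "J_from G v0 1 v (i # ns) = (\<Sum>w \<in> sphere G i v. scale ?c (J_from G v0 1 w ns))"
    by (simp add: J_from_eq_scale[where D = "card (sphere G i v)"])
  also have "\<dots> = (\<Sum>w \<in> sphere G i v.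
      foldl (\<lambda>f i. gprod G v0 f (xb i)) (scale ?c (xb (gdist G v0 w))) ns)"
    \<comment> \<open>The induction hypothesis applies at each \<open>w\<close>, and the weight
      moves inside the fold.\<close>
    using Cons by (intro sum.cong) (auto simp: foldl_gprod_scale sphere_def)
  also have "\<dots> = foldl (\<lambda>f i. gprod G v0 f (xb i)) (basis_prod G v0 (gdist G v0 v) i) ns"
    using Cons.prems by (simp add: basis_prod_eq_average foldl_gprod_sum)
  finally show ?case by (simp add: gprod_basis)
qed simp

lemma PL_eq_J:
  assumes "ns \<noteq> []" "set ns \<subseteq> levels G v0"
  shows "PL G v0 ns = J G v0 ns"
proof -
  obtain i js where ns: "ns = i # js"
    using assms by (cases ns) auto
  then have i: "i \<in> levels G v0" and js: "set js \<subseteq> levels G v0"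
    using assms by auto
  let ?n = "card (sphere G i v0)"
  \<comment> \<open>Every \<open>w\<close> has level \<open>i\<close>, so the fold starts at
    \<open>xb i\<close> whichever \<open>w\<close> is reached.\<close>
  have "J_from G v0 1 w js = PL G v0 ns" if "w \<in> sphere G i v0" for w
    using that J_from_eq_foldl_gprod[OF js, of w] by (simp add: ns PL_def sphere_def)
  then have "J G v0 ns = (\<Sum>w \<in> sphere G i v0. scale (1 / of_nat ?n) (PL G v0 ns))"
    by (simp add: J_def ns J_from_eq_scale[where D = ?n])
  also have "\<dots> = PL G v0 ns"
    using card_base_sphere_pos[OF i]
    by (intro poly_mapping_eqI, subst lookup_sum) simp
  finally show ?thesis ..
qed

end

theorem theorem4p5:
  fixes G :: "'a pair_pre_digraph" and v0 :: 'a
  assumes "pointed_graph G v0"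
    and S1: "\<forall>i \<in> levels G v0. \<forall>u \<in> pverts G. \<forall>v \<in> pverts G.
               card (sphere G i u) = card (sphere G i v)"
    and S2: "\<forall>i \<in> levels G v0. \<forall>j \<in> levels G v0. \<forall>k \<in> levels G v0.
               \<forall>u \<in> sphere G k v0. \<forall>v \<in> sphere G k v0.
               card (sphere G i u \<inter> sphere G j v0) = card (sphere G i v \<inter> sphere G j v0)"
  shows "\<forall>ns. ns \<noteq> [] \<and> set ns \<subseteq> levels G v0 \<longrightarrow> PL G v0 ns = J G v0 ns"
proof -
  interpret pointed_graph G v0 by fact
  interpret distance_homogeneous_graph G v0
  proof unfold_locales
    show "card (sphere G i u) = card (sphere G i v)"
      if "i \<in> levels G v0" "u \<in> pverts G" "v \<in> pverts G" for i u v
      using S1 that by blast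
    show "card (sphere G i u \<inter> sphere G j v0) = card (sphere G i v \<inter> sphere G j v0)"
      if "i \<in> levels G v0" "j \<in> levels G v0" "k \<in> levels G v0"
        "u \<in> sphere G k v0" "v \<in> sphere G k v0" for i j k u v
      using S2 that by blast
  qed
  show ?thesis using PL_eq_J by blast
qed

end
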